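(* (i) Let $G$ be a profinite group such that every open normal subgroup of $G$ is a $\Phi^\lhd$-group. Then every open subgroup of $G$ is a $\Phi^\lhd$-group. (ii) Let $G$ be a just infinite profinite group. Then $G$ is a hereditary $\Phi^\lhd$-group.
   Context: All subgroups are closed. A profinite group is just infinite if it is infinite and every non-trivial normal subgroup has finite index. The normal Frattini subgroup $\Phi^\lhd(G)$ of a profinite group $G$ is the intersection of all maximal closed normal subgroups of $G$, equivalently the intersection of the open normal subgroups $N$ such that $G/N$ is simple (with $\Phi^\lhd(1)=1$). $G$ is a $\Phi^\lhd$-group if $\Phi^\lhd(G)$ has finite index in $G$; $G$ is a hereditary $\Phi^\lhd$-group if every open subgroup of $G$ is a $\Phi^\lhd$-group. *)

theory Defs
  imports "HOL-Analysis.Analysis" "HOL-Algebra.Coset"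
begin

text \<open>
  A topological group is an algebraic group \<open>G\<close> together with an abstract topology \<open>T\<close> whose
  underlying set is the carrier. A subgroup \<open>H\<close> is itself regarded as a topological group via
  \<open>G\<lparr>carrier := H\<rparr>\<close> and \<open>subtopology T H\<close>.
\<close>

locale topological_group = group G for G (structure) +
  fixes T :: "'a topology"
  assumes topspace_eq: "topspace T = carrier G"
    and continuous_mult: "continuous_map (prod_topology T T) T (\<lambda>(x, y). x \<otimes> y)"
    and continuous_inv: "continuous_map T T (\<lambda>x. inv x)"

locale profinite_group = topological_group G T for G (structure) and T +
  assumes compact: "compact_space T"
    and hausdorff: "Hausdorff_space T"
    and totally_disconnected: "connectedin T S \<Longrightarrow> x \<in> S \<Longrightarrow> y \<in> S \<Longrightarrow> x = y"

definition open_subgroup :: "'a set \<Rightarrow> ('a, 'b) monoid_scheme \<Rightarrow> 'a topology \<Rightarrow> bool" where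
  "open_subgroup H G T \<longleftrightarrow> subgroup H G \<and> openin T H"

definition open_normal_subgroup :: "'a set \<Rightarrow> ('a, 'b) monoid_scheme \<Rightarrow> 'a topology \<Rightarrow> bool" where
  "open_normal_subgroup N G T \<longleftrightarrow> N \<lhd> G \<and> openin T N"

definition closed_normal_subgroup :: "'a set \<Rightarrow> ('a, 'b) monoid_scheme \<Rightarrow> 'a topology \<Rightarrow> bool" where
  "closed_normal_subgroup N G T \<longleftrightarrow> N \<lhd> G \<and> closedin T N"

definition maximal_closed_normal_subgroup ::
    "'a set \<Rightarrow> ('a, 'b) monoid_scheme \<Rightarrow> 'a topology \<Rightarrow> bool" where
  "maximal_closed_normal_subgroup N G T \<longleftrightarrow>
     closed_normal_subgroup N G T \<and> N \<noteq> carrier G \<and>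
     (\<forall>M. closed_normal_subgroup M G T \<and> M \<noteq> carrier G \<and> N \<subseteq> M \<longrightarrow> M = N)"

definition finite_index :: "'a set \<Rightarrow> ('a, 'b) monoid_scheme \<Rightarrow> bool" where
  "finite_index H G \<longleftrightarrow> finite (rcosets\<^bsub>G\<^esub> H)"

text \<open>
  Intersecting with the carrier makes the empty intersection equal to the whole group, so that the
  normal Frattini subgroup of the trivial group is trivial.
\<close>

definition normal_frattini :: "('a, 'b) monoid_scheme \<Rightarrow> 'a topology \<Rightarrow> 'a set" where
  "normal_frattini G T = carrier G \<inter> \<Inter>{N. maximal_closed_normal_subgroup N G T}"

text \<open>
  The next three notions are only meant for profinite groups; profiniteness is not part of the
  predicates. It is inherited by open (hence closed) subgroups of a profinite group.
\<close>

definition phi_group :: "('a, 'b) monoid_scheme \<Rightarrow> 'a topology \<Rightarrow> bool" where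
  "phi_group G T \<longleftrightarrow> finite_index (normal_frattini G T) G"

definition hereditary_phi_group :: "('a, 'b) monoid_scheme \<Rightarrow> 'a topology \<Rightarrow> bool" where
  "hereditary_phi_group G T \<longleftrightarrow>
     (\<forall>H. open_subgroup H G T \<longrightarrow> phi_group (G\<lparr>carrier := H\<rparr>) (subtopology T H))"

text \<open>Subgroups of profinite groups are understood to be closed.\<close>

definition just_infinite :: "('a, 'b) monoid_scheme \<Rightarrow> 'a topology \<Rightarrow> bool" where
  "just_infinite G T \<longleftrightarrow>
     infinite (carrier G) \<and>
     (\<forall>N. closed_normal_subgroup N G T \<and> N \<noteq> {\<one>\<^bsub>G\<^esub>} \<longrightarrow> finite_index N G)"

end

theory Submission
  imports Defs "HOL-Algebra.SndIsomorphismGrp" "HOL-Algebra.Generated_Groups"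
begin

text \<open>
  Write \<open>\<Phi>(G)\<close> for the normal Frattini subgroup.

  The first part rests on the inclusion \<open>\<Phi>(N) \<subseteq> \<Phi>(G)\<close> for every closed normal subgroup \<open>N\<close> of a
  profinite group \<open>G\<close> (\<open>normal_frattini_mono\<close>). Indeed, if \<open>M\<close> is maximal closed normal in \<open>G\<close> and
  does not contain \<open>N\<close>, then \<open>MN = G\<close> and \<open>M \<inter> N\<close> is maximal closed normal in \<open>N\<close>. An open subgroup
  \<open>H\<close> of \<open>G\<close> contains an open normal subgroup \<open>N\<close> of \<open>G\<close>. If \<open>\<Phi>(N)\<close> has finite index in \<open>N\<close>, it has
  finite index in \<open>H\<close>, and hence so does the larger group \<open>\<Phi>(H)\<close>.

  By the first part, the second one only concerns an open normal subgroup \<open>N\<close> of a just infinite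
  group \<open>G\<close>. The subgroup \<open>\<Phi>(N)\<close> is characteristic in \<open>N\<close>, hence normal in \<open>G\<close>
  (\<open>normal_frattini_closed_normal_in_overgroup\<close>), so it has finite index unless it is trivial. Suppose
  that it is trivial, let \<open>M\<close> be maximal closed normal in \<open>N\<close>, and let \<open>K\<close> be minimal among the closed
  normal subgroups of \<open>N\<close> not contained in \<open>M\<close> (\<open>minimal_supplement\<close>). Minimality and \<open>\<Phi>(N) = 1\<close>
  force \<open>K \<inter> M = 1\<close>, so \<open>K\<close> is finite because \<open>M\<close> is open (\<open>frattini_trivial_imp_finite_normal\<close>). As
  \<open>K\<close> is normal in \<open>N\<close>, it has finitely many conjugates in \<open>G\<close>, and these generate a finite normal
  subgroup of \<open>G\<close> (\<open>finite_normal_closure\<close>). A just infinite group has no non-trivial finite normal subgroup.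
\<close>

section \<open>Subgroups of finite index\<close>

context group
begin

text \<open>
  Finite index is used below through a finite set of representatives that meets every right coset, not
  necessarily only once.\<close>

lemma finite_index_iff:
  assumes "subgroup H G"
  shows "finite_index H G \<longleftrightarrow>
    (\<exists>R. finite R \<and> R \<subseteq> carrier G \<and> (\<forall>g\<in>carrier G. \<exists>h\<in>H. \<exists>r\<in>R. g = h \<otimes> r))"
    (is "_ \<longleftrightarrow> ?rhs")
proof
  interpret H: subgroup H G by fact
  assume "finite_index H G"
  moreover have "rcosets H = (\<lambda>g. H #> g) ` carrier G"
    by (auto simp: RCOSETS_def)
  ultimately obtain R where R: "finite R" "R \<subseteq> carrier G" "rcosets H = (\<lambda>g. H #> g) ` R"
    unfolding finite_index_def using finite_subset_image[of "rcosets H" "\<lambda>g. H #> g" "carrier G"] by auto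
  have "\<exists>h\<in>H. \<exists>r\<in>R. g = h \<otimes> r" if g: "g \<in> carrier G" for g
  proof -
    have "H #> g \<in> rcosets H"
      using g H.subset by (simp add: rcosetsI)
    then obtain r where "r \<in> R" "H #> g = H #> r"
      using R by auto
    then show ?thesis
      using rcos_self[OF g assms] unfolding r_coset_def by auto
  qed
  then show ?rhs
    using R by blast
next
  interpret H: subgroup H G by fact
  assume ?rhs
  then obtain R where R: "finite R" "R \<subseteq> carrier G"
      "\<And>g. g \<in> carrier G \<Longrightarrow> \<exists>h\<in>H. \<exists>r\<in>R. g = h \<otimes> r"
    by blast
  have "rcosets H \<subseteq> (\<lambda>r. H #> r) ` R"
  proof
    fix c assume "c \<in> rcosets H"
    then obtain g where g: "g \<in> carrier G" "c = H #> g"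
      by (auto simp: RCOSETS_def)
    then obtain h r where hr: "h \<in> H" "r \<in> R" "g = h \<otimes> r"
      using R by blast
    have "H #> g = H #> r"
      using hr R(2) assms repr_independence[of g H r] by (auto simp: r_coset_def)
    then show "c \<in> (\<lambda>r. H #> r) ` R"
      using g hr by blast
  qed
  then show "finite_index H G"
    unfolding finite_index_def using R(1) by (rule finite_surj[rotated])
qed

lemma finite_index_mono:
  assumes "subgroup H G" "subgroup K G" "H \<subseteq> K" "finite_index H G"
  shows "finite_index K G"
proof -
  obtain R where R: "finite R" "R \<subseteq> carrier G" "\<forall>g\<in>carrier G. \<exists>h\<in>H. \<exists>r\<in>R. g = h \<otimes> r"
    using assms(4) unfolding finite_index_iff[OF assms(1)] by (elim exE conjE)
  have "\<forall>g\<in>carrier G. \<exists>h\<in>K. \<exists>r\<in>R. g = h \<otimes> r"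
    using R(3) assms(3) by (metis subsetD)
  then show ?thesis
    unfolding finite_index_iff[OF assms(2)] using R(1,2) by (intro exI[of _ R] conjI)
qed

lemma finite_index_trans:
  assumes N: "subgroup N G" and P: "subgroup P (G\<lparr>carrier := N\<rparr>)"
    and fP: "finite_index P (G\<lparr>carrier := N\<rparr>)" and fN: "finite_index N G"
  shows "finite_index P G"
proof -
  interpret N: group "G\<lparr>carrier := N\<rparr>"
    using N by (rule subgroup_imp_group)
  have P': "subgroup P G"
    using N P by (rule incl_subgroup)
  obtain R where R: "finite R" "R \<subseteq> carrier G" "\<And>g. g \<in> carrier G \<Longrightarrow> \<exists>h\<in>N. \<exists>r\<in>R. g = h \<otimes> r"
    using fN finite_index_iff[OF N] by blast
  obtain S where S: "finite S" "S \<subseteq> N" "\<And>n. n \<in> N \<Longrightarrow> \<exists>p\<in>P. \<exists>s\<in>S. n = p \<otimes> s"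
    using fP N.finite_index_iff[OF P] by auto
  have sub: "P \<subseteq> carrier G" "N \<subseteq> carrier G"
    using P' N by (auto dest: subgroup.subset)
  have "\<exists>p\<in>P. \<exists>t\<in>(\<lambda>(s, r). s \<otimes> r) ` (S \<times> R). g = p \<otimes> t" if g: "g \<in> carrier G" for g
  proof -
    obtain n r where nr: "n \<in> N" "r \<in> R" "g = n \<otimes> r"
      using R(3)[OF g] by blast
    obtain p s where ps: "p \<in> P" "s \<in> S" "n = p \<otimes> s"
      using S(3)[OF nr(1)] by blast
    have "g = p \<otimes> (s \<otimes> r)"
      using nr ps S(2) R(2) sub by (simp add: m_assoc subset_iff)
    then show ?thesis
      using ps(1,2) nr(2) by auto
  qed
  moreover have "(\<lambda>(s, r). s \<otimes> r) ` (S \<times> R) \<subseteq> carrier G"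
    using S(2) R(2) sub by (auto intro!: m_closed)
  ultimately show ?thesis
    unfolding finite_index_iff[OF P'] using S(1) R(1)
    by (intro exI[of _ "(\<lambda>(s, r). s \<otimes> r) ` (S \<times> R)"]) simp
qed

lemma finite_index_restrict:
  assumes "H \<subseteq> carrier G" "finite_index P G"
  shows "finite_index P (G\<lparr>carrier := H\<rparr>)"
proof -
  have "rcosets\<^bsub>G\<lparr>carrier := H\<rparr>\<^esub> P \<subseteq> rcosets P"
    using assms(1) by (auto simp: RCOSETS_def r_coset_def)
  then show ?thesis
    using assms(2) unfolding finite_index_def by (rule finite_subset)
qed

lemma finite_index_finite_imp_finite:
  assumes "subgroup H G" "finite_index H G" "finite H"
  shows "finite (carrier G)"
proof -
  have "finite (\<Union>(rcosets H))"
    using assms(2) rcosets_finite[OF _ subgroup.subset[OF assms(1)] assms(3)]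
    unfolding finite_index_def by simp
  then show ?thesis
    using rcosets_part_G[OF assms(1)] by simp
qed

lemma finite_index_Int_trivial_imp_finite:
  assumes M: "subgroup M G" "finite_index M G" and K: "subgroup K G" "K \<inter> M = {\<one>}"
  shows "finite K"
proof -
  interpret M: subgroup M G by fact
  interpret K: subgroup K G by fact
  have "inj_on (\<lambda>k. M #> k) K"
  proof (rule inj_onI)
    fix x y assume xy: "x \<in> K" "y \<in> K" "M #> x = M #> y"
    then have "x \<in> M #> y"
      using rcos_self[OF _ M(1), of x] by simp
    then have "x \<otimes> inv y \<in> M"
      using xy by (auto simp: r_coset_def m_assoc)
    moreover have "x \<otimes> inv y \<in> K"
      using xy by simp
    ultimately have "x \<otimes> inv y = \<one>"
      using K(2) by blast
    then show "x = y"
      using xy inv_equality[of x "inv y"] by simp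
  qed
  moreover have "(\<lambda>k. M #> k) ` K \<subseteq> rcosets M"
    using rcosetsI[OF M.subset] by auto
  ultimately show ?thesis
    using M(2) unfolding finite_index_def by (rule inj_on_finite)
qed

lemma finite_normal_cover:
  assumes "finite F" "\<And>A. A \<in> F \<Longrightarrow> A \<lhd> G \<and> finite A"
  obtains D where "D \<lhd> G" "finite D" "\<Union>F \<subseteq> D"
proof -
  have "\<exists>D. D \<lhd> G \<and> finite D \<and> \<Union>F \<subseteq> D"
    using assms
  proof (induction F rule: finite_induct)
    case empty
    then show ?case
      using one_is_normal by auto
  next
    case (insert A F)
    then obtain D where D: "D \<lhd> G" "finite D" "\<Union>F \<subseteq> D"
      by auto
    have A: "A \<lhd> G" "finite A"
      using insert by auto
    interpret A: normal A G by fact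
    interpret D: normal D G by fact
    have "x \<in> A <#> D" if "x \<in> A" for x
      using that A.subset unfolding set_mult_def by (force intro: bexI[of _ \<one>])
    moreover have "x \<in> A <#> D" if "x \<in> D" for x
      using that D.subset unfolding set_mult_def by (force intro: bexI[of _ \<one>])
    moreover have "finite (A <#> D)"
      using A D by (simp add: set_mult_def)
    ultimately show ?case
      using D A normal_subgroup_set_mult_closed[OF A(1) D(1)]
      by (intro exI[of _ "A <#> D"]) auto
  qed
  then show thesis
    using that by (elim exE conjE)
qed

end

section \<open>Conjugation\<close>

context group
begin

lemma mult_inv_cancel:
  assumes "g \<in> carrier G" "x \<in> carrier G"
  shows "g \<otimes> (inv g \<otimes> x) = x"
  using assms by (simp add: m_assoc[symmetric])

text \<open>Conjugation by \<open>g\<close>, as the left action \<open>x \<mapsto> g x g\<^sup>-\<^sup>1\<close>.\<close>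

definition conjg :: "'a \<Rightarrow> 'a \<Rightarrow> 'a" where
  "conjg g x = g \<otimes> x \<otimes> inv g"

lemma conjg_closed [simp]: "g \<in> carrier G \<Longrightarrow> x \<in> carrier G \<Longrightarrow> conjg g x \<in> carrier G"
  by (simp add: conjg_def)

lemma conjg_one_left [simp]: "x \<in> carrier G \<Longrightarrow> conjg \<one> x = x"
  by (simp add: conjg_def)

lemma conjg_conjg:
  assumes "g \<in> carrier G" "h \<in> carrier G" "x \<in> carrier G"
  shows "conjg g (conjg h x) = conjg (g \<otimes> h) x"
  using assms by (simp add: conjg_def m_assoc inv_mult_group)

lemma conjg_inv_conjg [simp]:
  assumes "g \<in> carrier G" "x \<in> carrier G"
  shows "conjg (inv g) (conjg g x) = x" "conjg g (conjg (inv g) x) = x"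
  using assms by (simp_all add: conjg_conjg)

lemma conjg_mult:
  assumes "g \<in> carrier G" "x \<in> carrier G" "y \<in> carrier G"
  shows "conjg g (x \<otimes> y) = conjg g x \<otimes> conjg g y"
  using assms by (simp add: conjg_def m_assoc inv_solve_left)

lemma conjg_inv:
  assumes "g \<in> carrier G" "x \<in> carrier G"
  shows "conjg g (inv x) = inv (conjg g x)"
  using assms by (simp add: conjg_def m_assoc inv_mult_group)

lemma normal_in_subgroup_iff:
  assumes N: "subgroup N G"
  shows "K \<lhd> G\<lparr>carrier := N\<rparr> \<longleftrightarrow> subgroup K G \<and> K \<subseteq> N \<and> (\<forall>n\<in>N. \<forall>k\<in>K. conjg n k \<in> K)"
proof -
  interpret N: group "G\<lparr>carrier := N\<rparr>"
    using N by (rule subgroup_imp_group)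
  have "subgroup K (G\<lparr>carrier := N\<rparr>) \<longleftrightarrow> subgroup K G \<and> K \<subseteq> N"
    using incl_subgroup[OF N] subgroup_incl[OF _ N] subgroup.subset[of K "G\<lparr>carrier := N\<rparr>"] by auto
  then show ?thesis
    using N by (simp add: N.normal_inv_iff conjg_def)
qed

lemma normal_iff_conjg: "N \<lhd> G \<longleftrightarrow> subgroup N G \<and> (\<forall>g\<in>carrier G. \<forall>x\<in>N. conjg g x \<in> N)"
  by (simp add: normal_inv_iff conjg_def)

lemma normal_conjg_image:
  assumes N: "N \<lhd> G" and K: "K \<lhd> G\<lparr>carrier := N\<rparr>" and g: "g \<in> carrier G"
  shows "conjg g ` K \<lhd> G\<lparr>carrier := N\<rparr>"
proof -
  interpret N: normal N G by fact
  have N': "subgroup N G"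
    by (rule N.subgroup_axioms)
  have K': "subgroup K G" "K \<subseteq> N" "\<And>n k. n \<in> N \<Longrightarrow> k \<in> K \<Longrightarrow> conjg n k \<in> K"
    using K unfolding normal_in_subgroup_iff[OF N'] by auto
  interpret K: subgroup K G by fact
  have NC: "conjg h n \<in> N" if "h \<in> carrier G" "n \<in> N" for h n
    using N that unfolding normal_iff_conjg by blast
  have "subgroup (conjg g ` K) G"
  proof (rule subgroupI)
    show "conjg g ` K \<subseteq> carrier G"
      using g by auto
    show "conjg g ` K \<noteq> {}"
      using K.one_closed by blast
  next
    fix a assume "a \<in> conjg g ` K"
    then obtain k where "k \<in> K" "a = conjg g k" by blast
    then show "inv a \<in> conjg g ` K"
      using g conjg_inv[of g k] by (intro image_eqI[of _ _ "inv k"]) simp_all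
  next
    fix a b assume "a \<in> conjg g ` K" "b \<in> conjg g ` K"
    then obtain k l where "k \<in> K" "a = conjg g k" "l \<in> K" "b = conjg g l" by blast
    then show "a \<otimes> b \<in> conjg g ` K"
      using g conjg_mult[of g k l] by (intro image_eqI[of _ _ "k \<otimes> l"]) simp_all
  qed
  moreover have "conjg g ` K \<subseteq> N"
    using NC g K'(2) by blast
  moreover have "conjg n (conjg g k) \<in> conjg g ` K" if n: "n \<in> N" and k: "k \<in> K" for n k
  proof -
    define m where "m = conjg (inv g) n"
    have m: "m \<in> N" "m \<in> carrier G"
      using NC n g by (auto simp: m_def)
    have "g \<otimes> m = n \<otimes> g"
      using g n by (simp add: m_def conjg_def m_assoc mult_inv_cancel)
    then have "conjg n (conjg g k) = conjg g (conjg m k)"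
      using g n k m by (simp add: conjg_conjg)
    then show ?thesis
      using K'(3)[OF m(1) k] by blast
  qed
  ultimately show ?thesis
    unfolding normal_in_subgroup_iff[OF N'] by blast
qed

text \<open>
  Every conjugate of \<open>K\<close> in \<open>G\<close> is normal in \<open>N\<close> and lies in any normal subgroup of \<open>N\<close> containing
  the conjugates by a right transversal of \<open>N\<close>. The product of these finitely many conjugates is finite.
\<close>

lemma finite_normal_closure:
  assumes N: "N \<lhd> G" and fN: "finite_index N G" and K: "K \<lhd> G\<lparr>carrier := N\<rparr>" "finite K"
  obtains D where "D \<lhd> G" "finite D" "K \<subseteq> D"
proof -
  have N': "subgroup N G"
    using N by (rule normal_imp_subgroup)
  interpret N: group "G\<lparr>carrier := N\<rparr>"
    using N' by (rule subgroup_imp_group)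
  have Ksub: "K \<subseteq> carrier G"
    using K(1) unfolding normal_in_subgroup_iff[OF N'] using subgroup.subset by blast
  obtain R where R: "finite R" "R \<subseteq> carrier G" "\<forall>g\<in>carrier G. \<exists>n\<in>N. \<exists>r\<in>R. g = n \<otimes> r"
    using fN unfolding finite_index_iff[OF N'] by (elim exE conjE)
  obtain E where E: "E \<lhd> G\<lparr>carrier := N\<rparr>" "finite E" "\<Union>((\<lambda>r. conjg r ` K) ` R) \<subseteq> E"
  proof (rule N.finite_normal_cover)
    show "finite ((\<lambda>r. conjg r ` K) ` R)"
      using R(1) by (rule finite_imageI)
    show "A \<lhd> G\<lparr>carrier := N\<rparr> \<and> finite A" if "A \<in> (\<lambda>r. conjg r ` K) ` R" for A
      using that R(2) K normal_conjg_image[OF N K(1)] by auto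
  qed
  have E': "subgroup E G" "\<And>n k. n \<in> N \<Longrightarrow> k \<in> E \<Longrightarrow> conjg n k \<in> E"
    using E(1) unfolding normal_in_subgroup_iff[OF N'] by auto
  define C where "C = (\<Union>g\<in>carrier G. conjg g ` K)"
  have "conjg g k \<in> E" if g: "g \<in> carrier G" and k: "k \<in> K" for g k
  proof -
    obtain n r where nr: "n \<in> N" "r \<in> R" "g = n \<otimes> r"
      using R(3) g by blast
    have "conjg r k \<in> E"
      using E(3) nr(2) k by blast
    then have "conjg n (conjg r k) \<in> E"
      using E'(2) nr(1) by blast
    moreover have "n \<in> carrier G" "r \<in> carrier G" "k \<in> carrier G"
      using nr R(2) k Ksub subgroup.mem_carrier[OF N'] by auto
    ultimately show ?thesis
      by (simp add: nr(3) conjg_conjg)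
  qed
  then have CE: "C \<subseteq> E"
    by (auto simp: C_def)
  have Csub: "C \<subseteq> carrier G"
    using Ksub by (auto simp: C_def)
  have "generate G C \<lhd> G"
  proof (rule normal_generateI[OF Csub])
    fix h g assume "h \<in> C" and g: "g \<in> carrier G"
    then obtain a k where a: "a \<in> carrier G" "k \<in> K" "h = conjg a k"
      by (auto simp: C_def)
    then have "conjg g h = conjg (g \<otimes> a) k"
      using g Ksub by (simp add: conjg_conjg subset_iff)
    then show "g \<otimes> h \<otimes> inv g \<in> C"
      using g a by (auto simp: C_def conjg_def[symmetric] intro!: bexI[of _ "g \<otimes> a"])
  qed
  moreover have "finite (generate G C)"
    using generate_subgroup_incl[OF CE E'(1)] E(2) by (rule finite_subset)
  moreover have "K \<subseteq> generate G C"
  proof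
    fix k assume k: "k \<in> K"
    then have "k \<in> conjg \<one> ` K"
      using Ksub by (intro image_eqI[of _ _ k]) auto
    then show "k \<in> generate G C"
      by (intro generate.incl) (auto simp: C_def)
  qed
  ultimately show thesis
    by (rule that)
qed

end

section \<open>Clopen neighbourhoods\<close>

text \<open>
  In a compact Hausdorff totally disconnected space every singleton is a connected component, and a
  compact component has arbitrarily small clopen neighbourhoods.
\<close>

lemma clopen_neighbourhood:
  assumes comp: "compact_space X" and haus: "Hausdorff_space X"
    and td: "\<And>S x y. connectedin X S \<Longrightarrow> x \<in> S \<Longrightarrow> y \<in> S \<Longrightarrow> x = y"
    and W: "openin X W" "x \<in> W"
  obtains V where "openin X V" "closedin X V" "x \<in> V" "V \<subseteq> W"
proof -
  have x: "x \<in> topspace X"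
    using W openin_subset by blast
  have "connected_component_of_set X x = {x}"
  proof (intro equalityI subsetI)
    fix y assume "y \<in> connected_component_of_set X x"
    moreover have "x \<in> connected_component_of_set X x"
      using x by (simp add: connected_component_of_refl)
    ultimately have "y = x"
      by (rule td[OF connectedin_connected_component_of])
    then show "y \<in> {x}"
      by simp
  qed (use x in \<open>simp add: connected_component_of_refl\<close>)
  then have C: "{x} \<in> connected_components_of X"
    using x by (metis connected_component_in_connected_components_of)
  have "locally_compact_space X"
    using comp by (simp add: compact_imp_locally_compact_space)
  moreover have "compactin X {x}"
    using x by simp
  ultimately obtain U V where UV: "openin X U" "openin X V" "disjnt U V" "U \<union> V = topspace X"
      "{x} \<subseteq> U" "U \<subseteq> W"
    using wilder_locally_compact_component_thm[OF _ haus C _ W(1)] W(2) by blast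
  have "U = topspace X - V"
    using UV by (auto simp: disjnt_def dest: openin_subset)
  then have "closedin X U"
    using UV by blast
  then show thesis
    using UV that by blast
qed

section \<open>Topological groups\<close>

context topological_group
begin

lemma continuous_map_mult:
  assumes "continuous_map X T f" "continuous_map X T g"
  shows "continuous_map X T (\<lambda>x. f x \<otimes> g x)"
proof -
  have "continuous_map X (prod_topology T T) (\<lambda>x. (f x, g x))"
    using assms by (simp add: continuous_map_paired)
  then show ?thesis
    using continuous_map_compose[OF _ continuous_mult] by (force simp: o_def)
qed

lemma continuous_map_const_mult:
  assumes "a \<in> carrier G" "continuous_map X T f"
  shows "continuous_map X T (\<lambda>x. a \<otimes> f x)" "continuous_map X T (\<lambda>x. f x \<otimes> a)"
  using assms by (auto intro!: continuous_map_mult simp: topspace_eq)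

lemma continuous_conjg:
  assumes "g \<in> carrier G"
  shows "continuous_map T T (conjg g)"
  unfolding conjg_def using assms by (intro continuous_map_const_mult) auto

lemma homeomorphic_map_conjg:
  assumes "g \<in> carrier G"
  shows "homeomorphic_map T T (conjg g)"
proof (rule homeomorphic_maps_imp_map)
  show "homeomorphic_maps T T (conjg g) (conjg (inv g))"
    using assms by (simp add: homeomorphic_maps_def continuous_conjg topspace_eq)
qed

lemma homeomorphic_map_right_translation:
  assumes "g \<in> carrier G"
  shows "homeomorphic_map T T (\<lambda>x. x \<otimes> g)"
proof (rule homeomorphic_maps_imp_map)
  show "homeomorphic_maps T T (\<lambda>x. x \<otimes> g) (\<lambda>x. x \<otimes> inv g)"
    using assms
    by (auto simp: homeomorphic_maps_def topspace_eq m_assoc intro!: continuous_map_const_mult)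
qed

lemma r_coset_eq_image: "H #> g = (\<lambda>x. x \<otimes> g) ` H"
  by (auto simp: r_coset_def)

lemma openin_r_coset: "openin T H \<Longrightarrow> g \<in> carrier G \<Longrightarrow> openin T (H #> g)"
  unfolding r_coset_eq_image
  using homeomorphic_imp_open_map[OF homeomorphic_map_right_translation] by (auto simp: open_map_def)

lemma closedin_r_coset: "closedin T H \<Longrightarrow> g \<in> carrier G \<Longrightarrow> closedin T (H #> g)"
  unfolding r_coset_eq_image
  using homeomorphic_imp_closed_map[OF homeomorphic_map_right_translation] by (auto simp: closed_map_def)

lemma openin_subgroup_imp_closedin:
  assumes "subgroup H G" "openin T H"
  shows "closedin T H"
proof -
  have "openin T (topspace T - H)"
  proof (subst openin_subopen, intro ballI)
    fix x assume x: "x \<in> topspace T - H"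
    then have xG: "x \<in> carrier G"
      by (simp add: topspace_eq)
    have "(H #> x) \<inter> H = {}"
    proof (rule ccontr)
      assume "(H #> x) \<inter> H \<noteq> {}"
      then obtain h where h: "h \<in> H" "h \<otimes> x \<in> H"
        by (auto simp: r_coset_def)
      then have "inv h \<otimes> (h \<otimes> x) \<in> H"
        using assms(1) by (simp add: subgroup.m_closed subgroup.m_inv_closed)
      moreover have "inv h \<otimes> (h \<otimes> x) = x"
        using h(1) xG subgroup.mem_carrier[OF assms(1)] by (simp add: m_assoc[symmetric])
      ultimately show False
        using x by simp
    qed
    then show "\<exists>U. openin T U \<and> x \<in> U \<and> U \<subseteq> topspace T - H"
      using openin_r_coset[OF assms(2) xG] rcos_self[OF xG assms(1)] openin_subset
      by (intro exI[of _ "H #> x"]) blast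
  qed
  then show ?thesis
    using assms(2) openin_subset by (auto simp: closedin_def)
qed

lemma openin_subgroup_superset:
  assumes "subgroup H G" "openin T U" "subgroup U G" "U \<subseteq> H"
  shows "openin T H"
proof (subst openin_subopen, intro ballI)
  fix x assume x: "x \<in> H"
  then have xG: "x \<in> carrier G"
    using assms(1) by (rule subgroup.mem_carrier[rotated])
  have "U #> x \<subseteq> H"
    using assms(1,4) x by (auto simp: r_coset_def intro: subgroup.m_closed)
  then show "\<exists>V. openin T V \<and> x \<in> V \<and> V \<subseteq> H"
    using openin_r_coset[OF assms(2) xG] rcos_self[OF xG assms(3)] by blast
qed

lemma topological_group_subgroup:
  assumes H: "subgroup H G"
  shows "topological_group (G\<lparr>carrier := H\<rparr>) (subtopology T H)"
proof -
  interpret H: group "G\<lparr>carrier := H\<rparr>"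
    using H by (rule subgroup_imp_group)
  have sub: "H \<subseteq> carrier G"
    using H by (rule subgroup.subset)
  show ?thesis
  proof
    show "topspace (subtopology T H) = carrier (G\<lparr>carrier := H\<rparr>)"
      using sub by (auto simp: topspace_eq)
    show "continuous_map (prod_topology (subtopology T H) (subtopology T H)) (subtopology T H)
        (\<lambda>(x, y). x \<otimes>\<^bsub>G\<lparr>carrier := H\<rparr>\<^esub> y)"
      unfolding prod_topology_subtopology
      using continuous_map_from_subtopology[OF continuous_mult] H sub
      by (auto simp: continuous_map_in_subtopology subtopology_subtopology topspace_eq
          subgroup.m_closed)
    have "continuous_map (subtopology T H) (subtopology T H) (\<lambda>x. inv x)"
      using continuous_map_from_subtopology[OF continuous_inv] H
      by (auto simp: continuous_map_in_subtopology subgroup.m_inv_closed)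
    then show "continuous_map (subtopology T H) (subtopology T H)
        (\<lambda>x. inv\<^bsub>G\<lparr>carrier := H\<rparr>\<^esub> x)"
      by (rule continuous_map_eq) (use H in simp)
  qed
qed

lemma finite_index_open_subgroup:
  assumes comp: "compact_space T" and H: "subgroup H G" "openin T H"
  shows "finite_index H G"
proof -
  have "\<forall>g\<in>carrier G. openin T (H #> g)"
    using openin_r_coset[OF H(2)] by blast
  moreover have "topspace T \<subseteq> \<Union>((\<lambda>g. H #> g) ` carrier G)"
    using rcos_self[OF _ H(1)] by (auto simp: topspace_eq)
  ultimately obtain F where F: "finite F" "F \<subseteq> (\<lambda>g. H #> g) ` carrier G" "topspace T \<subseteq> \<Union>F"
    using comp[unfolded compact_space_alt] by (metis (no_types, lifting) imageE)
  then obtain R where R: "R \<subseteq> carrier G" "finite R" "F = (\<lambda>g. H #> g) ` R"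
    by (meson finite_subset_image)
  have "\<forall>g\<in>carrier G. \<exists>h\<in>H. \<exists>r\<in>R. g = h \<otimes> r"
    using F(3) unfolding R(3) topspace_eq r_coset_def by blast
  then show ?thesis
    unfolding finite_index_iff[OF H(1)] using R(1,2) by (intro exI[of _ R] conjI)
qed

end

section \<open>Profinite groups\<close>

context profinite_group
begin

lemma profinite_group_closed_subgroup:
  assumes H: "subgroup H G" "closedin T H"
  shows "profinite_group (G\<lparr>carrier := H\<rparr>) (subtopology T H)"
proof -
  interpret H: topological_group "G\<lparr>carrier := H\<rparr>" "subtopology T H"
    using H(1) by (rule topological_group_subgroup)
  show ?thesis
  proof
    show "compact_space (subtopology T H)"
      using compact H(2) closedin_compact_space compact_space_subtopology by blast
    show "Hausdorff_space (subtopology T H)"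
      using hausdorff by (rule Hausdorff_space_subtopology)
    show "x = y" if "connectedin (subtopology T H) S" "x \<in> S" "y \<in> S" for S x y
      using that totally_disconnected by (auto simp: connectedin_subtopology)
  qed
qed

text \<open>
  For a clopen neighbourhood \<open>V\<close> of \<open>\<one>\<close>, the elements \<open>x\<close> whose insertion between any two factors
  \<open>a\<close> and \<open>b\<close> does not affect whether the product lies in \<open>V\<close> form a normal subgroup contained in
  \<open>V\<close>. It is open because the group is compact and \<open>V\<close> is clopen.
\<close>

lemma open_normal_subgroup_basis:
  assumes W: "openin T W" "\<one> \<in> W"
  obtains U where "U \<lhd> G" "openin T U" "U \<subseteq> W"
proof -
  obtain V where V: "openin T V" "closedin T V" "\<one> \<in> V" "V \<subseteq> W"
  proof (rule clopen_neighbourhood[OF compact hausdorff _ W])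
    show "x = y" if "connectedin T S" "x \<in> S" "y \<in> S" for S x y
      using that by (rule totally_disconnected)
  qed
  define U where "U = {x \<in> carrier G. \<forall>a\<in>carrier G. \<forall>b\<in>carrier G. a \<otimes> x \<otimes> b \<in> V \<longleftrightarrow> a \<otimes> b \<in> V}"
  have UI: "x \<in> U" if "x \<in> carrier G"
      "\<And>a b. a \<in> carrier G \<Longrightarrow> b \<in> carrier G \<Longrightarrow> a \<otimes> x \<otimes> b \<in> V \<longleftrightarrow> a \<otimes> b \<in> V" for x
    using that by (simp add: U_def)
  have UD: "a \<otimes> x \<otimes> b \<in> V \<longleftrightarrow> a \<otimes> b \<in> V"
    if "x \<in> U" "a \<in> carrier G" "b \<in> carrier G" for x a b
    using that by (simp add: U_def)
  have Usub: "U \<subseteq> carrier G"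
    by (auto simp: U_def)
  have sg: "subgroup U G"
  proof (rule subgroupI)
    show "U \<subseteq> carrier G" by fact
    have "\<one> \<in> U"
      by (rule UI) simp_all
    then show "U \<noteq> {}"
      by blast
  next
    fix x assume x: "x \<in> U"
    then have xG: "x \<in> carrier G"
      using Usub by blast
    show "inv x \<in> U"
    proof (rule UI)
      fix a b assume "a \<in> carrier G" "b \<in> carrier G"
      then show "a \<otimes> inv x \<otimes> b \<in> V \<longleftrightarrow> a \<otimes> b \<in> V"
        using UD[OF x, of "a \<otimes> inv x" b] xG by (simp add: m_assoc)
    qed (use xG in simp)
  next
    fix x y assume x: "x \<in> U" and y: "y \<in> U"
    then have xy: "x \<in> carrier G" "y \<in> carrier G"
      using Usub by auto
    show "x \<otimes> y \<in> U"
    proof (rule UI)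
      fix a b assume ab: "a \<in> carrier G" "b \<in> carrier G"
      then show "a \<otimes> (x \<otimes> y) \<otimes> b \<in> V \<longleftrightarrow> a \<otimes> b \<in> V"
        using UD[OF x, of a "y \<otimes> b"] UD[OF y, of a b] xy by (simp add: m_assoc)
    qed (use xy in simp)
  qed
  have nm: "U \<lhd> G"
    unfolding normal_inv_iff
  proof (intro conjI ballI)
    fix g x assume g: "g \<in> carrier G" and x: "x \<in> U"
    then have xG: "x \<in> carrier G"
      using Usub by blast
    show "g \<otimes> x \<otimes> inv g \<in> U"
    proof (rule UI)
      fix a b assume ab: "a \<in> carrier G" "b \<in> carrier G"
      have "a \<otimes> (g \<otimes> x \<otimes> inv g) \<otimes> b = (a \<otimes> g) \<otimes> x \<otimes> (inv g \<otimes> b)"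
           "(a \<otimes> g) \<otimes> (inv g \<otimes> b) = a \<otimes> b"
        using ab g xG by (simp_all add: m_assoc mult_inv_cancel)
      then show "a \<otimes> (g \<otimes> x \<otimes> inv g) \<otimes> b \<in> V \<longleftrightarrow> a \<otimes> b \<in> V"
        using UD[OF x, of "a \<otimes> g" "inv g \<otimes> b"] ab g by simp
    qed (use g xG in simp)
  qed (rule sg)
  have UW: "U \<subseteq> W"
    using UD[of _ \<one> \<one>] V Usub by fastforce
  \<comment> \<open>The complement of \<open>U\<close> is the projection of a closed set along a compact factor.\<close>
  define P where "P = prod_topology T (prod_topology T T)"
  have proj: "continuous_map P T fst" "continuous_map P T (\<lambda>z. fst (snd z))"
      "continuous_map P T (\<lambda>z. snd (snd z))"
    unfolding P_def
    using continuous_map_compose[OF continuous_map_snd continuous_map_fst]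
      continuous_map_compose[OF continuous_map_snd continuous_map_snd]
    by (force simp: o_def continuous_map_fst)+
  have cont: "continuous_map P T (\<lambda>z. fst (snd z) \<otimes> fst z \<otimes> snd (snd z))"
    "continuous_map P T (\<lambda>z. fst (snd z) \<otimes> snd (snd z))"
    by (intro continuous_map_mult proj)+
  define A where "A = {z \<in> topspace P. fst (snd z) \<otimes> fst z \<otimes> snd (snd z) \<in> V}"
  define B where "B = {z \<in> topspace P. fst (snd z) \<otimes> snd (snd z) \<in> V}"
  have "openin P A" "closedin P A" "openin P B" "closedin P B"
    unfolding A_def B_def using V(1,2) cont
    by (auto intro: openin_continuous_map_preimage closedin_continuous_map_preimage)
  then have "closedin P ((A - B) \<union> (B - A))"
    by (intro closedin_Un closedin_diff)
  moreover have "closed_map P T fst"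
    unfolding P_def using compact by (intro closed_map_fst) (simp add: compact_space_prod_topology)
  ultimately have "closedin T (fst ` ((A - B) \<union> (B - A)))"
    by (simp add: closed_map_def)
  moreover have "carrier G - U = fst ` ((A - B) \<union> (B - A))"
  proof (intro equalityI subsetI)
    fix x assume "x \<in> carrier G - U"
    then obtain a b where "x \<in> carrier G" "a \<in> carrier G" "b \<in> carrier G"
        "(a \<otimes> x \<otimes> b \<in> V) \<noteq> (a \<otimes> b \<in> V)"
      by (auto simp: U_def)
    then have "(x, a, b) \<in> (A - B) \<union> (B - A)"
      by (auto simp: A_def B_def P_def topspace_eq)
    then show "x \<in> fst ` ((A - B) \<union> (B - A))"
      by force
  next
    fix x assume "x \<in> fst ` ((A - B) \<union> (B - A))"
    then show "x \<in> carrier G - U"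
      by (auto simp: A_def B_def P_def topspace_eq U_def)
  qed
  ultimately have "openin T U"
    using Usub by (simp add: openin_closedin_eq topspace_eq)
  then show thesis
    using that nm UW by blast
qed

end

section \<open>The normal Frattini subgroup\<close>

lemma maximal_closed_normal_subgroupD:
  assumes "maximal_closed_normal_subgroup M G T"
  shows "closed_normal_subgroup M G T" "M \<noteq> carrier G"
    "\<And>K. closed_normal_subgroup K G T \<Longrightarrow> M \<subseteq> K \<Longrightarrow> K = carrier G \<or> K = M"
  using assms by (auto simp: maximal_closed_normal_subgroup_def)

lemma normal_frattini_subset_maximal:
  "maximal_closed_normal_subgroup M G T \<Longrightarrow> normal_frattini G T \<subseteq> M"
  by (auto simp: normal_frattini_def)

context topological_group
begin

lemma normal_frattini_closed_normal: "closed_normal_subgroup (normal_frattini G T) G T"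
proof -
  let ?S = "insert (carrier G) {N. maximal_closed_normal_subgroup N G T}"
  have S: "A \<lhd> G \<and> closedin T A" if "A \<in> ?S" for A
    using that closedin_topspace[of T] normal_iff_conjg subgroup_self
    by (auto simp: maximal_closed_normal_subgroup_def closed_normal_subgroup_def topspace_eq)
  have eq: "normal_frattini G T = \<Inter>?S"
    by (auto simp: normal_frattini_def)
  have "subgroup (\<Inter>?S) G"
    using S by (intro subgroups_Inter) (auto dest: normal_imp_subgroup)
  moreover have "conjg g x \<in> \<Inter>?S" if "g \<in> carrier G" "x \<in> \<Inter>?S" for g x
    using S that unfolding normal_iff_conjg by blast
  moreover have "closedin T (\<Inter>?S)"
    using S by (intro closedin_Inter) auto
  ultimately show ?thesis
    by (simp add: eq closed_normal_subgroup_def normal_iff_conjg)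
qed

lemma closed_normal_in_closed_subgroup_iff:
  assumes N: "subgroup N G" "closedin T N"
  shows "closed_normal_subgroup K (G\<lparr>carrier := N\<rparr>) (subtopology T N) \<longleftrightarrow>
    subgroup K G \<and> K \<subseteq> N \<and> closedin T K \<and> (\<forall>n\<in>N. \<forall>k\<in>K. conjg n k \<in> K)"
  using N unfolding closed_normal_subgroup_def normal_in_subgroup_iff[OF N(1)]
  by (auto simp: closedin_closed_subtopology)

lemma closed_normal_conjg_image:
  assumes N: "N \<lhd> G" "closedin T N" and g: "g \<in> carrier G"
    and M: "closed_normal_subgroup M (G\<lparr>carrier := N\<rparr>) (subtopology T N)"
  shows "closed_normal_subgroup (conjg g ` M) (G\<lparr>carrier := N\<rparr>) (subtopology T N)"
proof -
  have N': "subgroup N G"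
    using N(1) by (rule normal_imp_subgroup)
  have "closedin T M" "M \<lhd> G\<lparr>carrier := N\<rparr>"
    using M closed_normal_in_closed_subgroup_iff[OF N' N(2)]
    by (auto simp: closed_normal_subgroup_def)
  then have "closedin T (conjg g ` M)" "conjg g ` M \<lhd> G\<lparr>carrier := N\<rparr>"
    using homeomorphic_imp_closed_map[OF homeomorphic_map_conjg[OF g]] normal_conjg_image[OF N(1) _ g]
    by (auto simp: closed_map_def)
  then show ?thesis
    using normal_in_subgroup_iff[OF N'] N(2)
    by (auto simp: closed_normal_subgroup_def closedin_closed_subtopology)
qed

lemma maximal_conjg_image:
  assumes N: "N \<lhd> G" "closedin T N" and g: "g \<in> carrier G"
    and M: "maximal_closed_normal_subgroup M (G\<lparr>carrier := N\<rparr>) (subtopology T N)"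
  shows "maximal_closed_normal_subgroup (conjg g ` M) (G\<lparr>carrier := N\<rparr>) (subtopology T N)"
proof -
  have N': "subgroup N G"
    using N(1) by (rule normal_imp_subgroup)
  note cn = closed_normal_in_closed_subgroup_iff[OF N' N(2)]
  have sub: "K \<subseteq> carrier G" if "closed_normal_subgroup K (G\<lparr>carrier := N\<rparr>) (subtopology T N)" for K
    using that unfolding cn using subgroup.subset by blast
  have cancel: "conjg g ` conjg (inv g) ` K = K" "conjg (inv g) ` conjg g ` K = K"
    if "K \<subseteq> carrier G" for K
    using that g by (auto simp: image_image subset_iff)
  have MN: "M \<subseteq> carrier G" "N \<subseteq> carrier G"
    using sub maximal_closed_normal_subgroupD(1)[OF M] N' subgroup.subset by blast+
  have conjN: "conjg g ` N = N"
  proof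
    have *: "conjg h ` N \<subseteq> N" if "h \<in> carrier G" for h
      using N(1) that unfolding normal_iff_conjg by blast
    show "conjg g ` N \<subseteq> N"
      using g by (rule *)
    have "conjg g ` conjg (inv g) ` N \<subseteq> conjg g ` N"
      using * g by (intro image_mono) simp
    then show "N \<subseteq> conjg g ` N"
      by (simp add: cancel MN)
  qed
  show ?thesis
    unfolding maximal_closed_normal_subgroup_def
  proof (intro conjI allI impI)
    show "closed_normal_subgroup (conjg g ` M) (G\<lparr>carrier := N\<rparr>) (subtopology T N)"
      by (rule closed_normal_conjg_image[OF N g maximal_closed_normal_subgroupD(1)[OF M]])
    show "conjg g ` M \<noteq> carrier (G\<lparr>carrier := N\<rparr>)"
    proof
      assume "conjg g ` M = carrier (G\<lparr>carrier := N\<rparr>)"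
      then have "conjg g ` M = conjg g ` N"
        by (simp add: conjN)
      then have "conjg (inv g) ` conjg g ` M = conjg (inv g) ` conjg g ` N"
        by (rule arg_cong)
      then have "M = N"
        unfolding cancel(2)[OF MN(1)] cancel(2)[OF MN(2)] .
      then show False
        using maximal_closed_normal_subgroupD(2)[OF M] by simp
    qed
  next
    fix K assume "closed_normal_subgroup K (G\<lparr>carrier := N\<rparr>) (subtopology T N) \<and>
        K \<noteq> carrier (G\<lparr>carrier := N\<rparr>) \<and> conjg g ` M \<subseteq> K"
    then have K: "closed_normal_subgroup K (G\<lparr>carrier := N\<rparr>) (subtopology T N)"
        "K \<noteq> N" "conjg g ` M \<subseteq> K"
      by auto
    let ?K = "conjg (inv g) ` K"
    have "M \<subseteq> ?K"
      using image_mono[OF K(3), of "conjg (inv g)"] cancel(2)[OF MN(1)] by simp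
    moreover have "closed_normal_subgroup ?K (G\<lparr>carrier := N\<rparr>) (subtopology T N)"
      using K(1) g by (intro closed_normal_conjg_image[OF N]) simp_all
    ultimately have "?K = N \<or> ?K = M"
      using maximal_closed_normal_subgroupD(3)[OF M] by auto
    then have "conjg g ` ?K = N \<or> conjg g ` ?K = conjg g ` M"
      using conjN by auto
    then show "K = conjg g ` M"
      using cancel(1)[OF sub[OF K(1)]] K(2) by simp
  qed
qed

text \<open>
  Conjugation by elements of \<open>G\<close> permutes the maximal closed normal subgroups of \<open>N\<close>, hence
  preserves their intersection.
\<close>

lemma normal_frattini_closed_normal_in_overgroup:
  assumes N: "N \<lhd> G" "closedin T N"
  shows "closed_normal_subgroup (normal_frattini (G\<lparr>carrier := N\<rparr>) (subtopology T N)) G T"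
proof -
  let ?F = "normal_frattini (G\<lparr>carrier := N\<rparr>) (subtopology T N)"
  have N': "subgroup N G"
    using N(1) by (rule normal_imp_subgroup)
  interpret N: topological_group "G\<lparr>carrier := N\<rparr>" "subtopology T N"
    using N' by (rule topological_group_subgroup)
  have F: "subgroup ?F G" "?F \<subseteq> N" "closedin T ?F"
    using N.normal_frattini_closed_normal closed_normal_in_closed_subgroup_iff[OF N' N(2)] by auto
  have "conjg g x \<in> ?F" if g: "g \<in> carrier G" and x: "x \<in> ?F" for g x
  proof -
    have xG: "x \<in> carrier G"
      using x F(1) by (rule subgroup.mem_carrier[rotated])
    have "conjg g x \<in> N"
      using N(1) g x F(2) unfolding normal_iff_conjg by blast
    moreover have "conjg g x \<in> M"
      if M: "maximal_closed_normal_subgroup M (G\<lparr>carrier := N\<rparr>) (subtopology T N)" for M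
    proof -
      have "x \<in> conjg (inv g) ` M"
        using normal_frattini_subset_maximal[OF maximal_conjg_image[OF N _ M]] g x by auto
      then obtain m where m: "m \<in> M" "x = conjg (inv g) m"
        by blast
      have "subgroup M G"
        using maximal_closed_normal_subgroupD(1)[OF M] closed_normal_in_closed_subgroup_iff[OF N' N(2)]
        by blast
      then have "m \<in> carrier G"
        using m(1) by (rule subgroup.mem_carrier)
      then show ?thesis
        using m g by simp
    qed
    ultimately show ?thesis
      by (auto simp: normal_frattini_def)
  qed
  then show ?thesis
    using F by (simp add: closed_normal_subgroup_def normal_iff_conjg)
qed

end

context profinite_group
begin

lemma closed_normal_set_mult:
  assumes A: "closed_normal_subgroup A G T" and B: "closed_normal_subgroup B G T"
  shows "closed_normal_subgroup (A <#> B) G T" "A \<subseteq> A <#> B" "B \<subseteq> A <#> B"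
proof -
  have AB: "A \<lhd> G" "B \<lhd> G" "closedin T A" "closedin T B"
    using A B by (auto simp: closed_normal_subgroup_def)
  interpret A: normal A G by fact
  interpret B: normal B G by fact
  have "compactin T A" "compactin T B"
    using AB compact by (auto intro: closedin_compact_space)
  then have "compactin (prod_topology T T) (A \<times> B)"
    by (simp add: compactin_Times)
  then have "compactin T ((\<lambda>(x, y). x \<otimes> y) ` (A \<times> B))"
    using continuous_mult by (rule image_compactin)
  moreover have "(\<lambda>(x, y). x \<otimes> y) ` (A \<times> B) = A <#> B"
    by (auto simp: set_mult_def)
  ultimately have "closedin T (A <#> B)"
    using hausdorff compactin_imp_closedin by metis
  then show "closed_normal_subgroup (A <#> B) G T"
    using normal_subgroup_set_mult_closed[OF AB(1,2)] by (simp add: closed_normal_subgroup_def)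
  show "A \<subseteq> A <#> B"
    using A.subset unfolding set_mult_def by (force intro: bexI[of _ \<one>])
  show "B \<subseteq> A <#> B"
    using B.subset unfolding set_mult_def by (force intro: bexI[of _ \<one>])
qed

lemma set_mult_maximal:
  assumes M: "maximal_closed_normal_subgroup M G T" and K: "closed_normal_subgroup K G T"
    and nsub: "\<not> K \<subseteq> M"
  shows "M <#> K = carrier G"
  using maximal_closed_normal_subgroupD[OF M] closed_normal_set_mult[OF _ K, of M] nsub by metis

lemma Int_closed_normal:
  assumes "closed_normal_subgroup A G T" "closed_normal_subgroup B G T"
  shows "closed_normal_subgroup (A \<inter> B) G T"
  using assms unfolding closed_normal_subgroup_def normal_iff_conjg
  by (auto intro: subgroups_Inter_pair)

text \<open>The non-trivial inclusion of Dedekind's modular law.\<close>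

lemma modular_inclusion:
  assumes "subgroup A G" "subgroup B G" "subgroup K G" "B \<subseteq> K" "K \<subseteq> A <#> B"
  shows "K \<subseteq> (K \<inter> A) <#> B"
proof
  fix k assume k: "k \<in> K"
  then obtain a b where ab: "a \<in> A" "b \<in> B" "k = a \<otimes> b"
    using assms(5) by (auto simp: set_mult_def)
  have G: "a \<in> carrier G" "b \<in> carrier G"
    using ab assms subgroup.mem_carrier by metis+
  have "a = k \<otimes> inv b"
    using ab(3) G by (simp add: m_assoc)
  then have "a \<in> K"
    using k ab(2) assms(3,4) by (auto intro: subgroup.m_closed subgroup.m_inv_closed)
  then show "k \<in> (K \<inter> A) <#> B"
    using ab by (auto simp: set_mult_def)
qed

lemma normal_frattini_mono:
  assumes N: "closed_normal_subgroup N G T"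
  shows "normal_frattini (G\<lparr>carrier := N\<rparr>) (subtopology T N) \<subseteq> normal_frattini G T"
proof -
  let ?GN = "G\<lparr>carrier := N\<rparr>" and ?TN = "subtopology T N"
  have N': "N \<lhd> G" "closedin T N" "subgroup N G"
    using N by (auto simp: closed_normal_subgroup_def normal_imp_subgroup)
  note cn = closed_normal_in_closed_subgroup_iff[OF N'(3,2)]
  have NG: "N \<subseteq> carrier G"
    using N'(3) by (rule subgroup.subset)
  have "normal_frattini ?GN ?TN \<subseteq> M" if M: "maximal_closed_normal_subgroup M G T" for M
  proof (cases "N \<subseteq> M")
    case True
    then show ?thesis
      by (auto simp: normal_frattini_def)
  next
    case False
    have Mcn: "closed_normal_subgroup M G T"
      using M by (rule maximal_closed_normal_subgroupD)
    then have M': "M \<lhd> G" "closedin T M" "subgroup M G"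
      by (auto simp: closed_normal_subgroup_def normal_imp_subgroup)
    have MG: "M \<subseteq> carrier G"
      using M'(3) by (rule subgroup.subset)
    have MN: "M <#> N = carrier G"
      using M N False by (rule set_mult_maximal)
    have "maximal_closed_normal_subgroup (M \<inter> N) ?GN ?TN"
      unfolding maximal_closed_normal_subgroup_def
    proof (intro conjI allI impI)
      show "closed_normal_subgroup (M \<inter> N) ?GN ?TN"
        using Int_closed_normal[OF Mcn N] NG unfolding cn
        by (auto simp: closed_normal_subgroup_def normal_iff_conjg)
      show "M \<inter> N \<noteq> carrier ?GN"
        using False by auto
    next
      fix K assume "closed_normal_subgroup K ?GN ?TN \<and> K \<noteq> carrier ?GN \<and> M \<inter> N \<subseteq> K"
      then have K: "subgroup K G" "K \<subseteq> N" "closedin T K" "\<And>n k. n \<in> N \<Longrightarrow> k \<in> K \<Longrightarrow> conjg n k \<in> K"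
          "K \<noteq> N" "M \<inter> N \<subseteq> K"
        unfolding cn by auto
      have KG: "K \<subseteq> carrier G"
        using K(1) by (rule subgroup.subset)
      \<comment> \<open>\<open>M\<close> normalises \<open>K\<close>, because \<open>[M, K] \<subseteq> M \<inter> N \<subseteq> K\<close>.\<close>
      have MK: "conjg m k \<in> K" if m: "m \<in> M" and k: "k \<in> K" for m k
      proof -
        have G: "m \<in> carrier G" "k \<in> carrier G"
          using m k MG KG by auto
        have "conjg m k \<otimes> inv k \<in> N"
          using N'(1,3) G k K(2) unfolding normal_iff_conjg
          by (auto intro!: subgroup.m_closed subgroup.m_inv_closed)
        moreover have "conjg m k \<otimes> inv k = m \<otimes> conjg k (inv m)"
          using G by (simp add: conjg_def m_assoc)
        moreover have "m \<otimes> conjg k (inv m) \<in> M"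
          using M'(1,3) m G unfolding normal_iff_conjg
          by (auto intro!: subgroup.m_closed simp: subgroup.m_inv_closed)
        ultimately have "conjg m k \<otimes> inv k \<in> K"
          using K(6) by auto
        then have "conjg m k \<otimes> inv k \<otimes> k \<in> K"
          using K(1) k by (simp add: subgroup.m_closed)
        then show ?thesis
          using G by (simp add: m_assoc)
      qed
      have "conjg g k \<in> K" if g: "g \<in> carrier G" and k: "k \<in> K" for g k
      proof -
        obtain m n where mn: "m \<in> M" "n \<in> N" "g = m \<otimes> n"
          using g MN unfolding set_mult_def by blast
        have "conjg m (conjg n k) \<in> K"
          using MK K(4) mn k by blast
        then show ?thesis
          using mn MG NG KG k by (simp add: conjg_conjg subset_iff)
      qed
      then have Kcn: "closed_normal_subgroup K G T"
        using K by (simp add: closed_normal_subgroup_def normal_iff_conjg)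
      have "K \<subseteq> M"
      proof (rule ccontr)
        assume "\<not> K \<subseteq> M"
        then have "M <#> K = carrier G"
          using M Kcn by (intro set_mult_maximal)
        then have "N \<subseteq> (N \<inter> M) <#> K"
          using modular_inclusion[OF M'(3) K(1) N'(3) K(2)] NG by simp
        also have "\<dots> \<subseteq> K"
          using K(1,6) by (auto simp: set_mult_def intro: subgroup.m_closed)
        finally show False
          using K(2,5) by blast
      qed
      then show "K = M \<inter> N"
        using K(2,6) by blast
    qed
    then show ?thesis
      using normal_frattini_subset_maximal by blast
  qed
  then show ?thesis
    using NG by (auto simp: normal_frattini_def)
qed

text \<open>
  If \<open>x \<notin> M\<close>, some open normal subgroup \<open>U\<close> avoids the closed set \<open>M x\<close>. Then \<open>x \<notin> M U\<close>, so \<open>M U\<close>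
  is proper and maximality puts \<open>U\<close> inside \<open>M\<close>.
\<close>

lemma maximal_closed_normal_open:
  assumes M: "maximal_closed_normal_subgroup M G T"
  shows "openin T M"
proof -
  have Mcn: "closed_normal_subgroup M G T"
    using M by (rule maximal_closed_normal_subgroupD)
  then have M': "M \<lhd> G" "closedin T M" "subgroup M G"
    by (auto simp: closed_normal_subgroup_def normal_imp_subgroup)
  have MG: "M \<subseteq> carrier G"
    using M'(3) by (rule subgroup.subset)
  then obtain x where x: "x \<in> carrier G" "x \<notin> M"
    using maximal_closed_normal_subgroupD(2)[OF M] by blast
  let ?W = "topspace T - (M #> x)"
  have "\<one> \<notin> M #> x"
  proof
    assume "\<one> \<in> M #> x"
    then obtain m where m: "m \<in> M" "\<one> = m \<otimes> x"
      by (auto simp: r_coset_def)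
    then have "x = inv m"
      using inv_equality[of m x] inv_equality[of x m] x(1) MG by (metis inv_inv subsetD)
    then show False
      using x(2) m(1) M'(3) by (simp add: subgroup.m_inv_closed)
  qed
  moreover have "openin T ?W"
    using closedin_r_coset[OF M'(2) x(1)] by blast
  ultimately obtain U where U: "U \<lhd> G" "openin T U" "U \<subseteq> ?W"
    using open_normal_subgroup_basis[of ?W] by (auto simp: topspace_eq)
  have U': "subgroup U G" "U \<subseteq> carrier G"
    using U(1) normal_imp_subgroup subgroup.subset by blast+
  have Ucn: "closed_normal_subgroup U G T"
    using U openin_subgroup_imp_closedin[OF U'(1) U(2)] by (simp add: closed_normal_subgroup_def)
  have "x \<notin> M <#> U"
  proof
    assume "x \<in> M <#> U"
    then obtain m u where mu: "m \<in> M" "u \<in> U" "x = m \<otimes> u"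
      by (auto simp: set_mult_def)
    then have "u = inv m \<otimes> x"
      using MG U'(2) by (simp add: m_assoc[symmetric] subset_iff)
    then have "u \<in> M #> x"
      using mu(1) M'(3) by (auto simp: r_coset_def subgroup.m_inv_closed)
    then show False
      using mu(2) U(3) by blast
  qed
  then have "U \<subseteq> M"
    using set_mult_maximal[OF M Ucn] x(1) by blast
  then show ?thesis
    using openin_subgroup_superset[OF M'(3) U(2) U'(1)] by blast
qed

text \<open>
  Zorn's lemma applies because the complement of \<open>M\<close> is closed: by compactness, a descending chain of
  closed subgroups that all meet this complement has an intersection that meets it.
\<close>

lemma minimal_supplement:
  assumes M: "maximal_closed_normal_subgroup M G T"
  obtains K where "closed_normal_subgroup K G T" "\<not> K \<subseteq> M"
    "\<And>L. closed_normal_subgroup L G T \<Longrightarrow> L \<subseteq> K \<Longrightarrow> \<not> L \<subseteq> M \<Longrightarrow> L = K"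
proof -
  define S where "S = {K. closed_normal_subgroup K G T \<and> \<not> K \<subseteq> M}"
  have Mcn: "closed_normal_subgroup M G T" "M \<noteq> carrier G"
    using M by (auto dest: maximal_closed_normal_subgroupD)
  have MG: "M \<subseteq> carrier G"
    using Mcn by (auto simp: closed_normal_subgroup_def dest!: normal_imp_subgroup subgroup.subset)
  have GS: "carrier G \<in> S"
    using MG Mcn(2) closedin_topspace[of T] normal_iff_conjg subgroup_self
    by (auto simp: S_def closed_normal_subgroup_def topspace_eq)
  have clM: "closedin T (carrier G - M)"
    using maximal_closed_normal_open[OF M] topspace_eq by (metis closedin_diff closedin_topspace)
  have inter: "\<Inter>C \<in> S" if ne: "C \<noteq> {}" and CS: "C \<subseteq> S"
    and ch: "\<And>A B. A \<in> C \<Longrightarrow> B \<in> C \<Longrightarrow> A \<subseteq> B \<or> B \<subseteq> A" for C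
  proof -
    have C: "A \<lhd> G" "closedin T A" "\<not> A \<subseteq> M" if "A \<in> C" for A
      using that CS by (auto simp: S_def closed_normal_subgroup_def)
    have CG: "A \<subseteq> carrier G" if "A \<in> C" for A
      using that by (intro subgroup.subset normal_imp_subgroup C)
    have "subgroup (\<Inter>C) G"
      using C ne by (intro subgroups_Inter) (auto dest: normal_imp_subgroup)
    moreover have "conjg g x \<in> \<Inter>C" if "g \<in> carrier G" "x \<in> \<Inter>C" for g x
      using C that unfolding normal_iff_conjg by blast
    moreover have "closedin T (\<Inter>C)"
      using C ne by (intro closedin_Inter) auto
    moreover have "\<not> \<Inter>C \<subseteq> M"
    proof -
      let ?D = "(\<lambda>A. A \<inter> (carrier G - M)) ` C"
      have "closedin T D" if "D \<in> ?D" for D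
        using that C(2) clM by auto
      moreover have "\<Inter>F \<noteq> {}" if F: "finite F" "F \<subseteq> ?D" for F
      proof (cases "F = {}")
        case False
        obtain E where E: "E \<subseteq> C" "finite E" "F = (\<lambda>A. A \<inter> (carrier G - M)) ` E"
          using finite_subset_image[OF F] by blast
        have "\<exists>A\<in>E. \<forall>B\<in>E. A \<subseteq> B"
          using E(2) False[unfolded E(3) image_is_empty] E(1)
        proof (induction E rule: finite_ne_induct)
          case (insert X E)
          then obtain A where A: "A \<in> E" "\<forall>B\<in>E. A \<subseteq> B"
            by blast
          have "X \<subseteq> A \<or> A \<subseteq> X"
            using A(1) insert.prems by (intro ch) auto
          then show ?case
          proof
            assume "X \<subseteq> A"
            then show ?thesis
              using A(2) by (intro bexI[of _ X] ballI) auto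
          next
            assume "A \<subseteq> X"
            then show ?thesis
              using A by (intro bexI[of _ A] ballI) auto
          qed
        qed simp
        then obtain A where A: "A \<in> E" "\<forall>B\<in>E. A \<subseteq> B"
          by blast
        obtain a where "a \<in> A" "a \<notin> M" "a \<in> carrier G"
          using C(3)[of A] CG[of A] A(1) E(1) by blast
        then have "a \<in> \<Inter>F"
          using A(2) by (auto simp: E(3))
        then show ?thesis
          by blast
      qed simp
      ultimately have "\<Inter>?D \<noteq> {}"
        using compact unfolding compact_space_fip by (meson image_eqI)
      then show ?thesis
        using ne by auto
    qed
    ultimately show ?thesis
      by (simp add: S_def closed_normal_subgroup_def normal_iff_conjg)
  qed
  \<comment> \<open>Zorn's lemma yields maximal sets, so it is applied to the complements of the members of \<open>S\<close>.\<close>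
  have "\<exists>X\<in>uminus ` S. \<forall>Y\<in>uminus ` S. X \<subseteq> Y \<longrightarrow> Y = X"
  proof (rule subset_Zorn_nonempty)
    show "uminus ` S \<noteq> {}"
      using GS by blast
    fix D assume ne: "D \<noteq> {}" and D: "subset.chain (uminus ` S) D"
    have "\<Inter>(uminus ` D) \<in> S"
    proof (rule inter)
      show "uminus ` D \<noteq> {}"
        using ne by blast
      show "uminus ` D \<subseteq> S"
        using D by (auto simp: subset.chain_def)
      show "A \<subseteq> B \<or> B \<subseteq> A" if "A \<in> uminus ` D" "B \<in> uminus ` D" for A B
      proof -
        have "- A \<in> D" "- B \<in> D"
          using that by auto
        then have "- A \<subseteq> - B \<or> - B \<subseteq> - A"
          using D unfolding subset_chain_def by blast
        then show ?thesis
          by blast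
      qed
    qed
    moreover have "\<Union>D = - \<Inter>(uminus ` D)"
      by auto
    ultimately show "\<Union>D \<in> uminus ` S"
      by blast
  qed
  then obtain K where K: "K \<in> S" "\<And>L. L \<in> S \<Longrightarrow> L \<subseteq> K \<Longrightarrow> L = K"
    by auto
  show thesis
  proof (rule that[of K])
    show "closed_normal_subgroup K G T" "\<not> K \<subseteq> M"
      using K(1) by (simp_all add: S_def)
    show "L = K" if "closed_normal_subgroup L G T" "L \<subseteq> K" "\<not> L \<subseteq> M" for L
      using that by (intro K(2)) (simp_all add: S_def)
  qed
qed

lemma frattini_trivial_imp_finite_normal:
  assumes triv: "normal_frattini G T = {\<one>}" and nt: "carrier G \<noteq> {\<one>}"
  obtains K where "K \<lhd> G" "finite K" "K \<noteq> {\<one>}"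
proof -
  obtain M where M: "maximal_closed_normal_subgroup M G T"
    using triv nt by (auto simp: normal_frattini_def)
  have Mcn: "closed_normal_subgroup M G T"
    using M by (rule maximal_closed_normal_subgroupD)
  then have M': "subgroup M G"
    by (auto simp: closed_normal_subgroup_def normal_imp_subgroup)
  obtain K where K: "closed_normal_subgroup K G T" "\<not> K \<subseteq> M"
    and Kmin: "\<And>L. closed_normal_subgroup L G T \<Longrightarrow> L \<subseteq> K \<Longrightarrow> \<not> L \<subseteq> M \<Longrightarrow> L = K"
    using minimal_supplement[OF M] by metis
  have K': "K \<lhd> G" "subgroup K G"
    using K by (auto simp: closed_normal_subgroup_def normal_imp_subgroup)
  have KM: "closed_normal_subgroup (K \<inter> M) G T"
    using K(1) Mcn by (rule Int_closed_normal)
  then have KM': "subgroup (K \<inter> M) G"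
    by (auto simp: closed_normal_subgroup_def normal_imp_subgroup)
  have "K \<inter> M \<subseteq> M2" if M2: "maximal_closed_normal_subgroup M2 G T" for M2
  proof (rule ccontr)
    assume nsub: "\<not> K \<inter> M \<subseteq> M2"
    have M2cn: "closed_normal_subgroup M2 G T"
      using M2 by (rule maximal_closed_normal_subgroupD)
    then have M2': "subgroup M2 G"
      by (auto simp: closed_normal_subgroup_def normal_imp_subgroup)
    have KM2: "closed_normal_subgroup (K \<inter> M2) G T"
      using K(1) M2cn by (rule Int_closed_normal)
    \<comment> \<open>\<open>K \<inter> M2\<close> is properly contained in \<open>K\<close>, as \<open>M2\<close> does not even contain \<open>K \<inter> M\<close>.\<close>
    have "K \<inter> M2 \<subseteq> M"
      using Kmin[OF KM2] nsub by blast
    moreover have "K \<subseteq> (K \<inter> M2) <#> (K \<inter> M)"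
      using set_mult_maximal[OF M2 KM nsub] K'(2)
      by (intro modular_inclusion[OF M2' KM' K'(2)]) (auto dest: subgroup.subset)
    ultimately have "K \<subseteq> M"
      using subgroup.m_closed[OF M'] unfolding set_mult_def by blast
    then show False
      using K(2) by blast
  qed
  then have "K \<inter> M \<subseteq> normal_frattini G T"
    using subgroup.subset[OF K'(2)] by (auto simp: normal_frattini_def)
  then have "K \<inter> M = {\<one>}"
    using triv subgroup.one_closed[OF KM'] by blast
  then have "finite K"
    using finite_index_open_subgroup[OF compact M' maximal_closed_normal_open[OF M]] M' K'(2)
    by (intro finite_index_Int_trivial_imp_finite)
  moreover have "K \<noteq> {\<one>}"
    using K(2) subgroup.one_closed[OF M'] by blast
  ultimately show thesis
    using that K'(1) by blast
qed

section \<open>Open subgroups and just infinite groups\<close>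

lemma phi_group_if_finite_index_normal_phi:
  assumes N: "closed_normal_subgroup N G T" and fN: "finite_index N G"
    and phi: "phi_group (G\<lparr>carrier := N\<rparr>) (subtopology T N)"
  shows "phi_group G T"
proof -
  let ?F = "normal_frattini (G\<lparr>carrier := N\<rparr>) (subtopology T N)"
  have N': "N \<lhd> G" "closedin T N" "subgroup N G"
    using N by (auto simp: closed_normal_subgroup_def normal_imp_subgroup)
  interpret N: topological_group "G\<lparr>carrier := N\<rparr>" "subtopology T N"
    using N'(3) by (rule topological_group_subgroup)
  have F: "subgroup ?F (G\<lparr>carrier := N\<rparr>)" "subgroup (normal_frattini G T) G"
    using N.normal_frattini_closed_normal normal_frattini_closed_normal
    by (auto simp: closed_normal_subgroup_def normal_imp_subgroup)
  have "finite_index ?F G"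
    using finite_index_trans[OF N'(3) F(1)] phi fN by (simp add: phi_group_def)
  then show ?thesis
    unfolding phi_group_def
    using finite_index_mono[OF incl_subgroup[OF N'(3) F(1)] F(2)
        normal_frattini_mono[OF N]] by blast
qed

lemma open_normal_phi_imp_open_phi:
  assumes phi: "\<And>N. open_normal_subgroup N G T \<Longrightarrow>
      phi_group (G\<lparr>carrier := N\<rparr>) (subtopology T N)"
    and H: "open_subgroup H G T"
  shows "phi_group (G\<lparr>carrier := H\<rparr>) (subtopology T H)"
proof -
  have H': "subgroup H G" "openin T H" "\<one> \<in> H"
    using H subgroup.one_closed by (auto simp: open_subgroup_def)
  have clH: "closedin T H"
    using H'(1,2) by (rule openin_subgroup_imp_closedin)
  interpret H: profinite_group "G\<lparr>carrier := H\<rparr>" "subtopology T H"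
    using H'(1) clH by (rule profinite_group_closed_subgroup)
  obtain N where N: "N \<lhd> G" "openin T N" "N \<subseteq> H"
    using open_normal_subgroup_basis[OF H'(2,3)] by blast
  have N': "subgroup N G" "closedin T N" "N \<subseteq> carrier G"
    using N(1,2) openin_subgroup_imp_closedin[of N] subgroup.subset[of N G]
    by (simp_all add: normal_imp_subgroup)
  have "closed_normal_subgroup N (G\<lparr>carrier := H\<rparr>) (subtopology T H)"
    using N N' H'(1) subgroup.subset[OF H'(1)]
    unfolding closed_normal_in_closed_subgroup_iff[OF H'(1) clH] normal_iff_conjg by blast
  moreover have "finite_index N (G\<lparr>carrier := H\<rparr>)"
    using finite_index_restrict[OF subgroup.subset[OF H'(1)]]
      finite_index_open_subgroup[OF compact N'(1) N(2)] by blast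
  moreover have "phi_group (G\<lparr>carrier := N\<rparr>) (subtopology T N)"
    using N by (intro phi) (simp add: open_normal_subgroup_def)
  ultimately show ?thesis
    using H.phi_group_if_finite_index_normal_phi[of N] N(3)
    by (simp add: subtopology_subtopology Int_absorb1)
qed

lemma just_infinite_open_normal_phi:
  assumes ji: "just_infinite G T" and N: "open_normal_subgroup N G T"
  shows "phi_group (G\<lparr>carrier := N\<rparr>) (subtopology T N)"
proof -
  let ?F = "normal_frattini (G\<lparr>carrier := N\<rparr>) (subtopology T N)"
  have N': "N \<lhd> G" "openin T N" "subgroup N G"
    using N by (auto simp: open_normal_subgroup_def normal_imp_subgroup)
  have clN: "closedin T N"
    using N'(3,2) by (rule openin_subgroup_imp_closedin)
  have fN: "finite_index N G"
    using compact N'(3,2) by (rule finite_index_open_subgroup)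
  have inf: "infinite (carrier G)"
    and fin: "\<And>K. closed_normal_subgroup K G T \<Longrightarrow> K \<noteq> {\<one>} \<Longrightarrow> finite_index K G"
    using ji by (auto simp: just_infinite_def)
  interpret N: profinite_group "G\<lparr>carrier := N\<rparr>" "subtopology T N"
    using N'(3) clN by (rule profinite_group_closed_subgroup)
  have "?F \<noteq> {\<one>}"
  proof
    assume "?F = {\<one>}"
    moreover have "N \<noteq> {\<one>}"
      using finite_index_finite_imp_finite[OF N'(3) fN] inf by auto
    ultimately obtain K where K: "K \<lhd> G\<lparr>carrier := N\<rparr>" "finite K" "K \<noteq> {\<one>}"
      using N.frattini_trivial_imp_finite_normal by auto
    obtain D where D: "D \<lhd> G" "finite D" "K \<subseteq> D"
      using finite_normal_closure[OF N'(1) fN K(1,2)] by blast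
    have D': "subgroup D G" "D \<subseteq> carrier G"
      using D(1) normal_imp_subgroup subgroup.subset by blast+
    have "closedin T D"
      using D(2) D'(2) hausdorff by (simp add: closedin_Hausdorff_finite topspace_eq)
    moreover have "D \<noteq> {\<one>}"
    proof -
      have "\<one> \<in> K"
        using subgroup.one_closed[OF normal_imp_subgroup[OF K(1)]] by simp
      then show ?thesis
        using K(3) D(3) by blast
    qed
    ultimately have "finite_index D G"
      using D(1) by (intro fin) (simp_all add: closed_normal_subgroup_def)
    then show False
      using finite_index_finite_imp_finite[OF D'(1)] D(2) inf by blast
  qed
  then have "finite_index ?F G"
    using normal_frattini_closed_normal_in_overgroup[OF N'(1) clN] by (intro fin)
  then show ?thesis
    unfolding phi_group_def
    using finite_index_restrict[OF subgroup.subset[OF N'(3)]] by blast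
qed

end

theorem corollary2p3:
  fixes G :: "('a, 'b) monoid_scheme" and T :: "'a topology"
  assumes "profinite_group G T"
  shows "((\<forall>N. open_normal_subgroup N G T \<longrightarrow>
              phi_group (G\<lparr>carrier := N\<rparr>) (subtopology T N)) \<longrightarrow>
          (\<forall>H. open_subgroup H G T \<longrightarrow>
              phi_group (G\<lparr>carrier := H\<rparr>) (subtopology T H))) \<and>
         (just_infinite G T \<longrightarrow> hereditary_phi_group G T)"
proof -
  interpret profinite_group G T
    by fact
  show ?thesis
    unfolding hereditary_phi_group_def
    using open_normal_phi_imp_open_phi just_infinite_open_normal_phi by blast
qed

end
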